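(* Let $q$ be a prime power, let $n,k$ be positive integers and $\gamma\in\mathbb{F}_{q^n}^*$. Then the polynomial $X+\gamma\,\mathrm{Tr}_{q^n/q}(X^k)$ is a permutation polynomial over $\mathbb{F}_{q^n}$ in each of the following cases: (a) $n=2$, $q\equiv \pm 1\pmod 6$, $\gamma=-1/3$, $k=2q-1$; (b) $n=2$, $q\equiv 5\pmod 6$, $\gamma^3=-1/27$, $k=2q-1$; (c) $n=2$, $q\equiv 1\pmod 3$, $\gamma=1$, $k=(q^2+q+1)/3$; (d) $n=2$, $q\equiv 1\pmod 4$, $(2\gamma)^{(q+1)/2}=1$, $k=(q+1)^2/4$; (e) $n=2$, $q=Q^2$ with $Q>0$ odd, $\gamma=-1$, $k=Q^3-Q+1$; (f) $n=2$, $q=Q^2$ with $Q>0$ odd, $\gamma=-1$, $k=Q^3+Q^2-Q$; (g) $n=3$, $q$ odd, $\gamma=1$, $k=(q^2+1)/2$; (h) $n=3$, $q$ odd, $\gamma=-1/2$, $k=q^2-q+1$; (i) $n=2\ell r$, $\gamma^{q^{2\ell}-1}=-1$, $k=q^\ell+1$, for some positive integers $\ell$ and $r$.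
   Context: $\mathbb{F}_q$ denotes the finite field with $q$ elements. $\mathrm{Tr}_{q^n/q}(X)$ denotes the polynomial $X^{q^{n-1}}+X^{q^{n-2}}+\dots+X^q+X$. A permutation polynomial over $\mathbb{F}_{q^n}$ is a polynomial in $\mathbb{F}_{q^n}[X]$ whose induced map $\mathbb{F}_{q^n}\to\mathbb{F}_{q^n}$ is a bijection. In (e),(f), $Q$ is a prime power. *)

theory Defs
  imports "HOL-Library.Cardinality" "HOL-Number_Theory.Number_Theory" "HOL-Computational_Algebra.Polynomial"
begin

definition trace_poly :: "nat \<Rightarrow> nat \<Rightarrow> 'a::comm_semiring_1 poly" where
  "trace_poly q n = (\<Sum>i<n. monom 1 (q ^ i))"

definition permutation_poly :: "'a::{field,finite} poly \<Rightarrow> bool" where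
  "permutation_poly f \<longleftrightarrow> bij (poly f)"

end

theory Submission
  imports Defs
begin

text \<open>
  Write \<open>\<sigma>\<close> for the Frobenius map and \<open>f\<close> for the polynomial function. Since the field is finite,
  injectivity of \<open>f\<close> suffices. Expressing \<open>x ^ k\<close> through the conjugates of \<open>x\<close> turns \<open>f\<close>
  into a rational function of these. If \<open>f x = f y\<close>, then \<open>x - y\<close> is \<open>\<gamma>\<close> times an element of
  the subfield.

  In cases (a), (e) and (h) the equation \<open>f x = f y\<close>, combined with its conjugates and divided by
  \<open>x - y\<close>, splits into factors; the conjugates of a vanishing factor vanish too, which is
  impossible unless \<open>x\<close> lies in the subfield, where \<open>f\<close> is linear. Case (b) reduces to (a) by
  scaling with a cube root of unity, and (f) is (e) with \<open>\<sigma>\<close> replaced by its inverse.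
  In (c) and (d), \<open>f x = x (1 + w + w\<^sup>2)\<close> or \<open>f x = 2 \<gamma> v (s + 1)\<close>, where the root of unity \<open>w\<close> or
  \<open>s\<close> is determined by \<open>f x\<close> and its conjugate. In (g), \<open>x = c z\<^sup>2\<close> with \<open>c\<close> in the subfield is
  mapped to \<open>c (z + \<sigma> z) (z + \<sigma>\<^sup>2 z)\<close>. In (i), the trace of \<open>x ^ k\<close> is a quadratic form with \<open>\<gamma>\<close>
  in its radical, hence it takes the same value at \<open>x\<close> and \<open>y\<close>.
\<close>

section \<open>Auxiliary identities in groups and commutative rings\<close>

lemma eq_minus_imp_eq_0:
  fixes u :: "'a::idom"
  assumes "(2::'a) \<noteq> 0" "u = - u"
  shows "u = 0"
proof -
  have "2 * u = 0"
    using assms(2) by (simp only: mult_2 eq_neg_iff_add_eq_0)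
  with assms(1) show ?thesis
    by simp
qed

lemma diff_eq_diff_of_common_shift:
  fixes u v p r :: "'a::ab_group_add"
  assumes "u - p = v - r" "u' - p = v' - r"
  shows "u - u' = v - v'"
proof -
  have "u - u' = (u - p) - (u' - p)" by simp
  also have "\<dots> = (v - r) - (v' - r)" by (simp only: assms)
  finally show ?thesis by simp
qed

text \<open>Up to constants, this is the numerator of the difference of two values of
  \<open>z - (z ^ 3 + w ^ 3) / (3 * (z * w))\<close>, with the factor \<open>c = x - y\<close> split
  off. Exchanging \<open>x\<close> with \<open>a\<close> and \<open>y\<close> with \<open>b\<close>
  fixes \<open>T\<close> and \<open>c\<close>, negates \<open>d\<close> and so swaps the other two
  factors. These are \<open>4 * (x * y - d * x + d\<^sup>2)\<close> and
  \<open>4 * (x * y - d * y + d\<^sup>2)\<close>, whence the 16.\<close>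

lemma cubic_cross_identity:
  fixes a c d x y b :: "'a::comm_ring_1"
  defines "T \<equiv> (x + a) * (y + b) + 3 * d\<^sup>2"
  assumes x: "x = a + d" and b: "b = a - c" and y: "y = a + d - c"
  shows "c * ((T - 2 * d * c) * (T + 2 * d * c)) = 16 *
    ((3 * x\<^sup>2 * a - x ^ 3 - a ^ 3) * (y * b) - (3 * y\<^sup>2 * b - y ^ 3 - b ^ 3) * (x * a))"
  unfolding T_def b y x by (simp add: algebra_simps power2_eq_square power3_eq_cube)

text \<open>
  The left-hand side is the numerator of \<open>\<phi> t - \<phi> 0\<close>, where
  \<open>\<phi> t + 2 t = (x + t) (b + t) / (a + t) + (a + t) (x + t) / (b + t) + (b + t) (a + t) / (x + t)\<close>.
  Up to affine normalisation \<open>\<phi>\<close> is the duplication map for abscissae on the elliptic curve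
  \<open>Y\<^sup>2 = (T + x) (T + a) (T + b)\<close>. Abscissae with the same double differ by a 2-torsion point,
  whence the three factors.
\<close>
lemma elliptic_doubling_identity:
  fixes x a b t :: "'a::comm_ring_1"
  shows "((x + t)\<^sup>2 * (b + t)\<^sup>2 + (a + t)\<^sup>2 * (x + t)\<^sup>2 + (b + t)\<^sup>2 * (a + t)\<^sup>2) * (x * a * b)
      - (x\<^sup>2 * b\<^sup>2 + a\<^sup>2 * x\<^sup>2 + b\<^sup>2 * a\<^sup>2) * ((x + t) * (a + t) * (b + t))
      - 2 * t * (x * a * b) * ((x + t) * (a + t) * (b + t))
    = t * (x * t + x * a + x * b - a * b) * (a * t + a * x + a * b - x * b) * (b * t + b * x + b * a - x * a)"
  by (simp add: algebra_simps power2_eq_square)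

section \<open>Field endomorphisms\<close>

text \<open>Serves several power maps at once: the Frobenius map, its iterates and, for case (f),
  its inverse. The order of \<sigma> enters the individual lemmas as the hypothesis
  \<open>inv\<close>.\<close>

locale field_endomorphism =
  fixes \<sigma> :: "'a::field \<Rightarrow> 'a"
  assumes add: "\<sigma> (x + y) = \<sigma> x + \<sigma> y"
    and mult: "\<sigma> (x * y) = \<sigma> x * \<sigma> y"
    and one: "\<sigma> 1 = 1"
begin

lemma zero: "\<sigma> 0 = 0"
  using add[of 0 0] add_cancel_left_right[of "\<sigma> 0" "\<sigma> 0"] by simp

lemma minus: "\<sigma> (- x) = - \<sigma> x"
  using add[of "- x" x] by (simp add: zero eq_neg_iff_add_eq_0)

lemma diff: "\<sigma> (x - y) = \<sigma> x - \<sigma> y"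
  using add[of x "- y"] by (simp add: minus)

lemma power: "\<sigma> (x ^ n) = \<sigma> x ^ n"
  by (induction n) (simp_all add: one mult)

lemma numeral: "\<sigma> (numeral n) = numeral n"
proof -
  have "\<sigma> (of_nat m) = of_nat m" for m
    by (induction m) (simp_all add: zero one add)
  from this[of "numeral n"] show ?thesis
    by simp
qed

lemma eq_0_iff: "\<sigma> x = 0 \<longleftrightarrow> x = 0"
proof
  assume "\<sigma> x = 0"
  then show "x = 0"
    using mult[of x "inverse x"] one by (cases "x = 0") auto
qed (simp add: zero)

lemma eq_iff: "\<sigma> x = \<sigma> y \<longleftrightarrow> x = y"
  using eq_0_iff[of "x - y"] by (simp add: diff)

lemma divide: "\<sigma> (x / y) = \<sigma> x / \<sigma> y"
proof (cases "y = 0")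
  case False
  then have "\<sigma> (x / y) * \<sigma> y = \<sigma> x"
    using mult[of "x / y" y] by simp
  with False show ?thesis
    by (simp add: eq_0_iff eq_divide_eq)
qed (simp add: zero)

lemmas hom = zero one add mult minus diff power numeral divide

section \<open>Injectivity of rational maps in the conjugates of a point\<close>

text \<open>Case (a). The fraction is invariant under \<sigma>, so the value determines
  \<open>x - \<sigma> x\<close>, and \<open>c = x - y\<close> is fixed by \<sigma>. The two factors
  in \<open>T\<close> from \<open>cubic_cross_identity\<close> are then conjugate and vanish
  together, forcing \<open>2 * d * c = 0\<close>.\<close>

lemma quadratic_cube_trace_inj:
  assumes inv: "\<And>x. \<sigma> (\<sigma> x) = x" and two: "(2::'a) \<noteq> 0" and three: "(3::'a) \<noteq> 0"
    and eq: "x - (x ^ 3 + \<sigma> x ^ 3) / (3 * (x * \<sigma> x)) = y - (y ^ 3 + \<sigma> y ^ 3) / (3 * (y * \<sigma> y))"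
  shows "x = y"
proof -
  define a b c d where "a = \<sigma> x" and "b = \<sigma> y" and "c = x - y" and "d = x - a"
  have sa: "\<sigma> x = a" "\<sigma> a = x" "\<sigma> y = b" "\<sigma> b = y"
    by (simp_all add: a_def b_def inv)
  have eq1: "x - (x ^ 3 + a ^ 3) / (3 * (x * a)) = y - (y ^ 3 + b ^ 3) / (3 * (y * b))"
    using eq by (simp add: sa)
  from arg_cong[OF this, of \<sigma>]
  have "a - (x ^ 3 + a ^ 3) / (3 * (x * a)) = b - (y ^ 3 + b ^ 3) / (3 * (y * b))"
    by (simp add: hom sa mult.commute add.commute)
  from this eq1 have ab: "a - x = b - y"
    by (rule diff_eq_diff_of_common_shift)
  show ?thesis
  proof (cases "a = x")
    case True
    with ab have "b = y" by simp
    \<comment> \<open>On the fixed field the map is division by 3; at 0 this rests on the convention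
      \<open>z / 0 = 0\<close>.\<close>
    have fixed: "z - (z ^ 3 + z ^ 3) / (3 * (z * z)) = z / 3" for z :: 'a
      using three by (cases "z = 0") (simp_all add: field_simps power3_eq_cube)
    from eq1 have "x / 3 = y / 3"
      unfolding True \<open>b = y\<close> fixed .
    with three show ?thesis
      by simp
  next
    case False
    with ab have "b \<noteq> y" by auto
    have nz: "x \<noteq> 0" "a \<noteq> 0" "y \<noteq> 0" "b \<noteq> 0"
      using False \<open>b \<noteq> y\<close> sa zero by metis+
    show ?thesis
    proof (rule ccontr)
      assume "x \<noteq> y"
      have y: "y = x - c" and b: "b = a - c" and x: "x = a + d"
        using ab by (simp_all add: c_def d_def algebra_simps)
      define T where "T = (x + a) * (y + b) + 3 * d\<^sup>2"
      have frac: "3 * (z - (z ^ 3 + w ^ 3) / (3 * (z * w))) = (3 * z\<^sup>2 * w - z ^ 3 - w ^ 3) / (z * w)"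
        if "z \<noteq> 0" "w \<noteq> 0" for z w :: 'a
        using that three by (simp add: field_simps power2_eq_square)
      from arg_cong[OF eq1, of "(*) 3"]
      have "(3 * x\<^sup>2 * a - x ^ 3 - a ^ 3) / (x * a) = (3 * y\<^sup>2 * b - y ^ 3 - b ^ 3) / (y * b)"
        by (simp only: frac nz not_False_eq_True)
      then have "(3 * x\<^sup>2 * a - x ^ 3 - a ^ 3) * (y * b) = (3 * y\<^sup>2 * b - y ^ 3 - b ^ 3) * (x * a)"
        using nz by (simp only: frac_eq_eq mult_eq_0_iff simp_thms)
      moreover have "c * ((T - 2 * d * c) * (T + 2 * d * c)) = 16 *
          ((3 * x\<^sup>2 * a - x ^ 3 - a ^ 3) * (y * b) - (3 * y\<^sup>2 * b - y ^ 3 - b ^ 3) * (x * a))"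
        using cubic_cross_identity[OF x b] y x by (simp add: T_def)
      ultimately have "c * ((T - 2 * d * c) * (T + 2 * d * c)) = 0"
        by simp
      moreover have "c \<noteq> 0"
        using \<open>x \<noteq> y\<close> by (simp add: c_def)
      ultimately have T: "T = 2 * d * c \<or> T = - (2 * d * c)"
        by (auto simp: eq_neg_iff_add_eq_0)
      \<comment> \<open>Conjugation fixes \<open>T\<close> and negates \<open>2 * d * c\<close>, so
        each alternative for \<open>T\<close> implies the other.\<close>
      have "\<sigma> c = c" "\<sigma> d = - d"
        using ab by (simp_all add: c_def d_def hom sa algebra_simps)
      moreover from this have "\<sigma> T = T"
        by (simp add: T_def hom sa algebra_simps)
      ultimately have "\<sigma> T = T" "\<sigma> (2 * d * c) = - (2 * d * c)" "\<sigma> (- (2 * d * c)) = 2 * d * c"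
        by (simp_all add: hom)
      with T have "2 * d * c = - (2 * d * c)" by metis
      then have "2 * d * c = 0"
        by (rule eq_minus_imp_eq_0[OF two])
      with two \<open>c \<noteq> 0\<close> False show False
        by (simp add: d_def)
    qed
  qed
qed

text \<open>
  With \<open>\<rho> = (W - Y) / (Z - X)\<close>, the hypothesis and its \<open>\<sigma>\<close>-conjugate combine to a difference of
  two squares, which forces \<open>Y W + 1 = - 2 \<rho>\<close>; a second difference of squares then gives a
  contradiction.
\<close>
lemma sigma_square_minus_one_map_inj:
  assumes two: "(2::'a) \<noteq> 0"
    and sig: "\<sigma> X = Y" "\<sigma> Y = - X" "\<sigma> Z = W" "\<sigma> W = - Z"
    and eq: "(X * Y\<^sup>2 + 3 * X - 4 * Y) * (W\<^sup>2 - 1) = (Z * W\<^sup>2 + 3 * Z - 4 * W) * (Y\<^sup>2 - 1)"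
  shows "X = Z"
proof (rule ccontr)
  assume "X \<noteq> Z"
  define D E where "D = Z - X" and "E = W - Y"
  define \<rho> where "\<rho> = E / D"
  define S R L M where "S = X + Z" and "R = Y + W" and "L = X * Z" and "M = Y * W"
  have "D \<noteq> 0"
    using \<open>X \<noteq> Z\<close> by (simp add: D_def)
  have sg: "\<sigma> D = E" "\<sigma> E = - D" "\<sigma> S = R" "\<sigma> R = - S" "\<sigma> L = M" "\<sigma> M = L"
    by (simp_all add: D_def E_def S_def R_def L_def M_def hom sig)
  then have "E \<noteq> 0"
    using \<open>D \<noteq> 0\<close> eq_0_iff by metis
  have E: "E = \<rho> * D" and "\<rho> \<noteq> 0" and sr: "\<sigma> \<rho> = - (1 / \<rho>)"
    using \<open>D \<noteq> 0\<close> \<open>E \<noteq> 0\<close> by (simp_all add: \<rho>_def hom sg)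
  have "2 * E * (S * R - 2 * M - 2) - D * (M\<^sup>2 + 2 * M + E\<^sup>2 - 3) =
      (X * Y\<^sup>2 + 3 * X - 4 * Y) * (W\<^sup>2 - 1) - (Z * W\<^sup>2 + 3 * Z - 4 * W) * (Y\<^sup>2 - 1)"
    unfolding D_def E_def S_def R_def M_def by (simp add: algebra_simps power2_eq_square)
  with eq have "2 * E * (S * R - 2 * M - 2) - D * (M\<^sup>2 + 2 * M + E\<^sup>2 - 3) = 0"
    by simp
  then have "D * (2 * \<rho> * (S * R - 2 * M - 2) - (M\<^sup>2 + 2 * M + E\<^sup>2 - 3)) = 0"
    by (simp add: E algebra_simps)
  with \<open>D \<noteq> 0\<close> have eq1: "2 * \<rho> * (S * R - 2 * M - 2) = M\<^sup>2 + 2 * M + E\<^sup>2 - 3"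
    by simp
  from arg_cong[OF this, of \<sigma>]
  have "- (2 * (1 / \<rho>) * (- (R * S) - 2 * L - 2)) = L\<^sup>2 + 2 * L + D\<^sup>2 - 3"
    by (simp add: hom sg sr)
  then have eq2: "2 * (R * S + 2 * L + 2) = \<rho> * (L\<^sup>2 + 2 * L + D\<^sup>2 - 3)"
    using \<open>\<rho> \<noteq> 0\<close> by (simp add: field_simps)
  have "(M + 1 + 2 * \<rho>)\<^sup>2 - (\<rho> * (L + 1) - 2)\<^sup>2 =
      \<rho> * (2 * (R * S + 2 * L + 2) - \<rho> * (L\<^sup>2 + 2 * L + D\<^sup>2 - 3)) -
      (2 * \<rho> * (S * R - 2 * M - 2) - (M\<^sup>2 + 2 * M + E\<^sup>2 - 3))"
    unfolding E by (simp add: algebra_simps power2_eq_square)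
  with eq1 eq2 have "(M + 1 + 2 * \<rho>)\<^sup>2 = (\<rho> * (L + 1) - 2)\<^sup>2"
    by simp
  then have "M + 1 + 2 * \<rho> = \<rho> * (L + 1) - 2 \<or> M + 1 + 2 * \<rho> = - (\<rho> * (L + 1) - 2)"
    by (rule power2_eq_iff[THEN iffD1])
  then have "M + 1 + 2 * \<rho> = 0"
  proof
    \<comment> \<open>Conjugating either alternative reproduces it with the opposite sign, so
      \<open>M + 1 + 2 * \<rho>\<close> equals its own negative.\<close>
    assume 1: "M + 1 + 2 * \<rho> = \<rho> * (L + 1) - 2"
    from arg_cong[OF this, of \<sigma>] have "L + 1 - 2 / \<rho> = - ((M + 1) / \<rho>) - 2"
      by (simp add: hom sg sr)
    then have "\<rho> * (L + 1) - 2 = - (M + 1 + 2 * \<rho>)"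
      using \<open>\<rho> \<noteq> 0\<close> by (simp add: field_simps)
    with 1 show ?thesis
      by (intro eq_minus_imp_eq_0[OF two]) simp
  next
    assume 1: "M + 1 + 2 * \<rho> = - (\<rho> * (L + 1) - 2)"
    from arg_cong[OF this, of \<sigma>] have "L + 1 - 2 / \<rho> = (M + 1) / \<rho> + 2"
      by (simp add: hom sg sr)
    then have "\<rho> * (L + 1) - 2 = M + 1 + 2 * \<rho>"
      using \<open>\<rho> \<noteq> 0\<close> by (simp add: field_simps)
    with 1 show ?thesis
      by (intro eq_minus_imp_eq_0[OF two]) simp
  qed
  then have M: "M = - 1 - 2 * \<rho>"
    by (simp add: algebra_simps eq_neg_iff_add_eq_0)
  from arg_cong[OF this, of \<sigma>] have L: "\<rho> * L = 2 - \<rho>"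
    using \<open>\<rho> \<noteq> 0\<close> by (simp add: hom sg sr field_simps)
  have "R\<^sup>2 = 4 * M + E\<^sup>2" "S\<^sup>2 = 4 * L + D\<^sup>2"
    by (simp_all add: R_def M_def E_def S_def L_def D_def power2_eq_square algebra_simps)
  then have "(R - \<rho> * S)\<^sup>2 = 4 * M + E\<^sup>2 + \<rho>\<^sup>2 * (4 * L + D\<^sup>2) - 2 * \<rho> * (S * R)"
    by (simp add: power2_diff power_mult_distrib mult_ac)
  also have "\<dots> = 4 * M + 2 * E\<^sup>2 + 4 * \<rho> * (\<rho> * L) - 2 * \<rho> * (S * R - 2 * M - 2) - 4 * \<rho> * (M + 1)"
    unfolding E by (simp add: algebra_simps power2_eq_square)
  also have "\<dots> = E\<^sup>2"
    unfolding eq1 L unfolding M by (simp add: algebra_simps power2_eq_square)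
  finally have "(R - \<rho> * S)\<^sup>2 = E\<^sup>2" .
  then have "R - \<rho> * S = E \<or> R - \<rho> * S = - E"
    by (rule power2_eq_iff[THEN iffD1])
  then have "E = 0"
  proof
    assume 1: "R - \<rho> * S = E"
    from arg_cong[OF this, of \<sigma>] have "- S + R / \<rho> = - D"
      by (simp add: hom sg sr)
    then have "R - \<rho> * S = - E"
      using \<open>\<rho> \<noteq> 0\<close> by (simp add: E field_simps)
    with 1 show ?thesis
      by (intro eq_minus_imp_eq_0[OF two]) simp
  next
    assume 1: "R - \<rho> * S = - E"
    from arg_cong[OF this, of \<sigma>] have "- S + R / \<rho> = D"
      by (simp add: hom sg sr)
    then have "R - \<rho> * S = E"
      using \<open>\<rho> \<noteq> 0\<close> by (simp add: E field_simps)
    with 1 show ?thesis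
      by (intro eq_minus_imp_eq_0[OF two]) simp
  qed
  with \<open>E \<noteq> 0\<close> show False by simp
qed

text \<open>Cases (e) and (f). The square of \<sigma> swaps the two fractions, so the value
  determines \<open>z - \<sigma> (\<sigma> z)\<close>. The quotient \<open>X z\<close> of
  \<open>z + \<sigma> (\<sigma> z)\<close> by this difference is negated by the square of \<sigma>,
  and \<open>f z\<close> is the difference times a function of \<open>X z\<close> and its conjugate.
  Hence \<open>sigma_square_minus_one_map_inj\<close> recovers \<open>X z\<close>, and with it
  \<open>z\<close>.\<close>

lemma quartic_trace_inj:
  assumes inv: "\<And>x. \<sigma> (\<sigma> (\<sigma> (\<sigma> x))) = x" and two: "(2::'a) \<noteq> 0"
    and f: "\<And>x. f x = x - (x * \<sigma> (\<sigma> (\<sigma> x)) / \<sigma> x + \<sigma> x * \<sigma> (\<sigma> x) / \<sigma> (\<sigma> (\<sigma> x)))"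
    and eq: "f x = f y"
  shows "x = y"
proof -
  have sym: "z - \<sigma> (\<sigma> z) = f z - \<sigma> (\<sigma> (f z))" for z
    by (simp add: f hom inv algebra_simps)
  have diff2: "x - \<sigma> (\<sigma> x) = y - \<sigma> (\<sigma> y)"
    using sym[of x] sym[of y] eq by simp
  show ?thesis
  proof (cases "\<sigma> (\<sigma> x) = x")
    case True
    then have "\<sigma> (\<sigma> y) = y" using diff2 by simp
    \<comment> \<open>Here both fractions equal \<open>z\<close>.\<close>
    have "f z = - z" if "\<sigma> (\<sigma> z) = z" for z
      using that by (cases "z = 0") (simp_all add: f eq_0_iff zero)
    with True \<open>\<sigma> (\<sigma> y) = y\<close> eq show ?thesis by simp
  next
    case False
    define G where "G X Y = (X * Y\<^sup>2 + 3 * X - 4 * Y) / (Y\<^sup>2 - 1)" for X Y :: 'a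
    define X where "X z = (z + \<sigma> (\<sigma> z)) / (z - \<sigma> (\<sigma> z))" for z
    have sX: "\<sigma> (\<sigma> (X z)) = - X z" for z
      using minus_divide_right[of "z + \<sigma> (\<sigma> z)" "z - \<sigma> (\<sigma> z)"]
      by (simp add: X_def hom inv add.commute)
    have *: "f z = (z - \<sigma> (\<sigma> z)) / 2 * (1 - G (X z) (\<sigma> (X z))) \<and> (\<sigma> (X z))\<^sup>2 \<noteq> 1"
      if nz: "\<sigma> (\<sigma> z) \<noteq> z" for z
    proof -
      define a b c where "a = \<sigma> z" and "b = \<sigma> a" and "c = \<sigma> b"
      have s: "\<sigma> z = a" "\<sigma> a = b" "\<sigma> b = c" "\<sigma> c = z"
        by (simp_all add: a_def b_def c_def inv)
      have "z \<noteq> 0"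
        using nz zero by auto
      then have nzs: "z \<noteq> 0" "a \<noteq> 0" "b \<noteq> 0" "c \<noteq> 0"
        by (simp_all add: a_def b_def c_def eq_0_iff)
      have ne: "z \<noteq> b" "a \<noteq> c"
        using nz s eq_iff[of z b] by auto
      define U where "U = (z + b) / (z - b)"
      define V where "V = (a + c) / (a - c)"
      have UV: "X z = U" "\<sigma> (X z) = V"
        by (simp_all add: X_def U_def V_def hom s)
      have z: "U * (z - b) = z + b" and a: "V * (a - c) = a + c"
        using ne by (simp_all add: U_def V_def)
      have four: "(4::'a) \<noteq> 0"
        using two power_eq_0_iff[of "2::'a" 2] by simp
      \<comment> \<open>Multiplying by \<open>(a - c)\<^sup>2\<close> turns
        \<open>V\<^sup>2 - 1\<close> into \<open>4 * a * c\<close>, which shows that the denominator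
        of \<open>G\<close> is nonzero and brings \<open>G U V\<close> back to the conjugates of
        \<open>z\<close>.\<close>
      have "(V\<^sup>2 - 1) * (a - c)\<^sup>2 = (V * (a - c))\<^sup>2 - (a - c)\<^sup>2"
        by (simp add: algebra_simps power2_eq_square)
      then have V1: "(V\<^sup>2 - 1) * (a - c)\<^sup>2 = 4 * a * c"
        unfolding a by (simp add: algebra_simps power2_eq_square)
      then have V1': "V\<^sup>2 - 1 \<noteq> 0"
        using nzs four by auto
      have "(U * V\<^sup>2 + 3 * U - 4 * V) * (a - c)\<^sup>2 * (z - b) =
          (U * (z - b)) * ((V * (a - c))\<^sup>2 + 3 * (a - c)\<^sup>2) - 4 * (V * (a - c)) * (a - c) * (z - b)"
        by (simp add: algebra_simps power2_eq_square)
      then have G: "(U * V\<^sup>2 + 3 * U - 4 * V) * (a - c)\<^sup>2 * (z - b) =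
          4 * (2 * (z * c\<^sup>2 + b * a\<^sup>2) - (z + b) * (a * c))"
        unfolding z a by (simp add: algebra_simps power2_eq_square)
      have "G U V = (U * V\<^sup>2 + 3 * U - 4 * V) * (a - c)\<^sup>2 * (z - b) / ((V\<^sup>2 - 1) * (a - c)\<^sup>2 * (z - b))"
        using ne by (simp add: G_def)
      then have "G U V = (2 * (z * c\<^sup>2 + b * a\<^sup>2) - (z + b) * (a * c)) / (a * c * (z - b))"
        unfolding V1 G mult.assoc[of "4::'a"] mult_divide_mult_cancel_left[OF four] .
      then have "(z - b) / 2 * (1 - G U V) = z - (z * c / a + a * b / c)"
        using nzs ne two
        by (simp add: field_simps power2_eq_square)
      then show ?thesis
        using V1' unfolding UV(2) unfolding UV(1) f s by simp
    qed
    have ny: "\<sigma> (\<sigma> y) \<noteq> y"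
      using False diff2 by auto
    have "G (X x) (\<sigma> (X x)) = G (X y) (\<sigma> (X y))"
      using *[OF False] *[OF ny] eq diff2 False ny two by auto
    with *[OF False] *[OF ny] have "X x = X y"
      by (intro sigma_square_minus_one_map_inj[OF two refl sX refl sX]) (simp add: G_def field_simps)
    then have "x + \<sigma> (\<sigma> x) = y + \<sigma> (\<sigma> y)"
      using False ny diff2 by (simp add: X_def)
    with diff2 have "(x + \<sigma> (\<sigma> x)) + (x - \<sigma> (\<sigma> x)) = (y + \<sigma> (\<sigma> y)) + (y - \<sigma> (\<sigma> y))"
      by (simp only:)
    then have "2 * x = 2 * y" by simp
    with two show ?thesis by simp
  qed
qed

text \<open>Case (h). The sum of fractions is invariant under \<sigma>, so \<open>t = y - x\<close>
  is fixed by \<sigma>. The three quadratic factors in \<open>elliptic_doubling_identity\<close> are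
  then permuted cyclically by \<sigma>, and it suffices to exclude the vanishing of one of
  them.\<close>

lemma cubic_trace_inj:
  assumes inv: "\<And>x. \<sigma> (\<sigma> (\<sigma> x)) = x" and two: "(2::'a) \<noteq> 0"
    and f: "\<And>x. f x = x - (x * \<sigma> (\<sigma> x) / \<sigma> x + \<sigma> x * x / \<sigma> (\<sigma> x) + \<sigma> (\<sigma> x) * \<sigma> x / x) / 2"
    and eq: "f x = f y"
  shows "x = y"
proof -
  define a b t where "a = \<sigma> x" and "b = \<sigma> a" and "t = y - x"
  have s: "\<sigma> x = a" "\<sigma> a = b" "\<sigma> b = x"
    by (simp_all add: a_def b_def inv)
  have sym: "z - \<sigma> z = f z - \<sigma> (f z)" for z
    by (simp add: f hom inv algebra_simps)
  have "x - \<sigma> x = y - \<sigma> y"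
    using sym[of x] sym[of y] eq by simp
  then have t: "\<sigma> t = t"
    by (simp add: t_def hom algebra_simps)
  have y: "y = x + t"
    by (simp add: t_def)
  have sy: "\<sigma> (x + t) = a + t" "\<sigma> (a + t) = b + t" "\<sigma> (b + t) = x + t"
    by (simp_all add: add s t)
  show ?thesis
  proof (cases "a = x")
    case True
    \<comment> \<open>On the fixed field all three fractions equal \<open>z\<close>, so
      \<open>f z = z - 3 * z / 2 = - z / 2\<close>, in characteristic 3 as well.\<close>
    have "3 / 2 = 1 + 1 / (2::'a)"
      using two by (simp add: field_simps)
    then have "f z = - z / 2" if "\<sigma> z = z" for z
      using that two by (cases "z = 0") (simp_all add: f field_simps)
    moreover have "\<sigma> x = x" "\<sigma> y = y"
      using True s by (simp_all add: y add t)
    ultimately have "- x / 2 = - y / 2"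
      using eq by simp
    then show ?thesis
      using two by simp
  next
    case False
    have ne: "x \<noteq> b" "a \<noteq> b"
      using False s eq_iff by metis+
    have nz: "x \<noteq> 0" "a \<noteq> 0" "b \<noteq> 0"
      using False s eq_0_iff zero by metis+
    have "x + t \<noteq> a + t"
      using False by simp
    then have nzt: "x + t \<noteq> 0" "a + t \<noteq> 0" "b + t \<noteq> 0"
      using sy eq_0_iff zero by metis+
    define N where "N x a b = x\<^sup>2 * b\<^sup>2 + a\<^sup>2 * x\<^sup>2 + b\<^sup>2 * a\<^sup>2" for x a b :: 'a
    have "x * b / a + a * x / b + b * a / x = N x a b / (x * a * b)"
      if "x \<noteq> 0" "a \<noteq> 0" "b \<noteq> 0" for x a b
      using that by (simp add: N_def field_simps power2_eq_square)
    then have "x - N x a b / (x * a * b) / 2 =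
        x + t - N (x + t) (a + t) (b + t) / ((x + t) * (a + t) * (b + t)) / 2"
      using eq nz nzt unfolding f y s sy by simp
    moreover have "n' * p - n * p' - 2 * t * p * p' = 0"
      if "x - n / p / 2 = x + t - n' / p' / 2" "p \<noteq> 0" "p' \<noteq> 0" for n n' p p'
    proof -
      have "n' / p' / 2 = t + n / p / 2"
        using that(1) by (simp add: algebra_simps)
      then have "2 * (n' / p' / 2) = 2 * t + 2 * (n / p / 2)"
        by (simp only: distrib_left)
      then have "n' / p' = 2 * t + n / p"
        using two by simp
      then show ?thesis
        using that(2,3) by (simp add: field_simps)
    qed
    ultimately have "N (x + t) (a + t) (b + t) * (x * a * b) - N x a b * ((x + t) * (a + t) * (b + t))
      - 2 * t * (x * a * b) * ((x + t) * (a + t) * (b + t)) = 0"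
      using nz nzt by (metis mult_eq_0_iff)
    then have "t * (x * t + x * a + x * b - a * b) * (a * t + a * x + a * b - x * b)
        * (b * t + b * x + b * a - x * a) = 0"
      using elliptic_doubling_identity[of x t b a] by (simp add: N_def)
    moreover have "x * t + x * a + x * b - a * b \<noteq> 0"
    proof
      assume 0: "x * t + x * a + x * b - a * b = 0"
      from arg_cong[OF this, of \<sigma>] have 1: "a * t + a * b + a * x - b * x = 0"
        by (simp add: hom s t)
      \<comment> \<open>The difference of the equation and its conjugate is a product. It gives
        \<open>t = - (2 * b)\<close>; since \<open>t\<close> is fixed, conjugation would make
        \<open>b\<close> and \<open>x\<close> equal.\<close>
      have "(x - a) * (t + 2 * b) = (x * t + x * a + x * b - a * b) - (a * t + a * b + a * x - b * x)"
        by (simp add: algebra_simps)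
      then have tb: "t = - (2 * b)"
        using 0 1 False by (simp add: eq_neg_iff_add_eq_0)
      from arg_cong[OF this, of \<sigma>] have "t = - (2 * x)"
        by (simp only: hom s t)
      with tb have "2 * b = 2 * x"
        by auto
      with two ne show False by simp
    qed
    moreover from this have "\<sigma> (x * t + x * a + x * b - a * b) \<noteq> 0"
        "\<sigma> (\<sigma> (x * t + x * a + x * b - a * b)) \<noteq> 0"
      by (simp_all only: eq_0_iff not_False_eq_True)
    ultimately have "t = 0"
      by (simp add: hom s t mult.commute add.commute add.left_commute)
    then show ?thesis
      by (simp add: t_def)
  qed
qed

text \<open>Case (g). As \<sigma> has odd order, \<open>z + \<sigma> z = 0\<close> only for
  \<open>z = 0\<close>, so it suffices to compare \<open>z = x + \<sigma> x\<close> with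
  \<open>w = y + \<sigma> y\<close>. Their ratio \<open>r\<close> satisfies
  \<open>r * \<sigma> (\<sigma> r) = d / c\<close>; conjugating this shows that \<open>r\<close> is
  fixed, hence \<open>x = r * y\<close> and \<open>c * r\<^sup>2 = d\<close>.\<close>

lemma cubic_norm_form_inj:
  assumes inv: "\<And>x. \<sigma> (\<sigma> (\<sigma> x)) = x" and two: "(2::'a) \<noteq> 0"
    and c: "\<sigma> c = c" "c \<noteq> 0" and d: "\<sigma> d = d" "d \<noteq> 0"
    and eq: "c * ((x + \<sigma> x) * (x + \<sigma> (\<sigma> x))) = d * ((y + \<sigma> y) * (y + \<sigma> (\<sigma> y)))"
  shows "c * x\<^sup>2 = d * y\<^sup>2"
proof -
  have ker: "z = 0" if "z + \<sigma> z = 0" for z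
  proof -
    have "\<sigma> z = - z"
      using that by (metis add.commute add_eq_0_iff)
    then have "\<sigma> (\<sigma> (\<sigma> z)) = - z"
      by (simp add: minus)
    then show ?thesis
      using eq_minus_imp_eq_0[OF two] inv by metis
  qed
  define z w where "z = x + \<sigma> x" and "w = y + \<sigma> y"
  have zw: "x + \<sigma> (\<sigma> x) = \<sigma> (\<sigma> z)" "y + \<sigma> (\<sigma> y) = \<sigma> (\<sigma> w)"
    by (simp_all add: z_def w_def add inv)
  have eq': "c * (z * \<sigma> (\<sigma> z)) = d * (w * \<sigma> (\<sigma> w))"
    using eq unfolding zw by (simp only: z_def w_def)
  show ?thesis
  proof (cases "w = 0")
    case True
    then have "z = 0"
      using eq' c by (simp add: eq_0_iff)
    with True have "x = 0" "y = 0"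
      using ker[of x, folded z_def] ker[of y, folded w_def] by simp_all
    then show ?thesis by simp
  next
    case False
    define r where "r = z / w"
    have "r * \<sigma> (\<sigma> r) = d / c"
      using eq' c False by (simp add: r_def hom field_simps eq_0_iff)
    moreover from arg_cong[OF this, of \<sigma>] have "\<sigma> r * r = d / c"
      by (simp add: hom inv c d)
    moreover have "d / c \<noteq> 0"
      using c d by simp
    ultimately have "\<sigma> (\<sigma> r) = \<sigma> r"
      by (metis mult.commute mult_cancel_left mult_zero_left)
    then have r: "\<sigma> r = r"
      by (simp only: eq_iff)
    have "z - r * w = 0"
      using False by (simp add: r_def)
    then have "(x - r * y) + \<sigma> (x - r * y) = 0"
      by (simp add: z_def w_def hom r algebra_simps)
    then have "x - r * y = 0"
      by (rule ker)
    then have "x = r * y"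
      by simp
    moreover have "c * (r * r) = d"
      using \<open>\<sigma> r * r = d / c\<close> r c by simp
    ultimately show ?thesis
      by (metis mult.assoc power2_eq_square power_mult_distrib)
  qed
qed

end

section \<open>Finite fields and the Frobenius map\<close>

lemma finite_field_power_CARD:
  fixes x :: "'a::{field,finite}"
  shows "x ^ CARD('a) = x"
proof (cases "x = 0")
  case False
  let ?U = "UNIV - {0::'a}"
  have "bij_betw ((*) x) ?U ?U"
    by (rule bij_betw_byWitness[where f' = "\<lambda>y. y / x"]) (use False in auto)
  then have "(\<Prod>y\<in>?U. x * y) = \<Prod>?U"
    by (rule prod.reindex_bij_betw)
  then have "x ^ card ?U * \<Prod>?U = 1 * \<Prod>?U"
    by (simp add: prod.distrib)
  then have "x ^ (CARD('a) - 1) = 1"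
    by (simp add: card_Diff_singleton)
  then show ?thesis
    using power_minus_mult[of "CARD('a)" x] by simp
qed (simp add: power_0_left)

text \<open>The characteristic divides \<open>q ^ n\<close>, so it is the prime underlying
  \<open>q\<close>. Thus \<open>q\<close> is a power of the characteristic, and its power map is
  additive.\<close>

lemma frobenius_endomorphism:
  fixes q n :: nat
  assumes q: "primepow q" and card: "CARD('a::{field,finite}) = q ^ n"
  shows "field_endomorphism (\<lambda>x::'a. x ^ q)" and "of_nat q = (0::'a)"
proof -
  have p: "prime CHAR('a)"
    by (rule prime_CHAR_semidom) (simp add: finite_imp_CHAR_pos)
  obtain r m where r: "prime r" "q = r ^ m" "m > 0"
    using q by (auto simp: primepow_def)
  have "CHAR('a) dvd r ^ (m * n)"
    using CHAR_dvd_CARD[where 'a = 'a] by (simp add: card r power_mult)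
  then have "CHAR('a) = r"
    using p r(1) by (metis prime_dvd_power primes_dvd_imp_eq)
  then have q: "q = CHAR('a) ^ m"
    using r by simp
  show "field_endomorphism (\<lambda>x::'a. x ^ q)"
    by standard (use freshmans_dream'[OF p q] in \<open>simp_all add: power_mult_distrib\<close>)
  show "of_nat q = (0::'a)"
    unfolding of_nat_eq_0_iff_char_dvd using q r(3) by (simp add: dvd_power)
qed

lemma permutation_poly_trace_iff_inj:
  fixes \<gamma> :: "'a::{field,finite}"
  shows "permutation_poly ([:0, 1:] + smult \<gamma> (pcompose (trace_poly q n) (monom 1 k))) \<longleftrightarrow>
    inj (\<lambda>x. x + \<gamma> * (\<Sum>i<n. (x ^ k) ^ q ^ i))"
proof -
  have "poly ([:0, 1:] + smult \<gamma> (pcompose (trace_poly q n) (monom 1 k))) =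
      (\<lambda>x. x + \<gamma> * (\<Sum>i<n. (x ^ k) ^ q ^ i))"
    by (simp add: fun_eq_iff trace_poly_def poly_pcompose poly_sum poly_monom)
  then show ?thesis
    unfolding permutation_poly_def bij_def
    using finite_UNIV_inj_surj[OF finite_class.finite_UNIV] by auto
qed

text \<open>Otherwise reducing \<open>q = m * (q div m) + 1\<close> in the field gives 0 = 1.
  Applied to \<open>m = 2\<close> and \<open>m = 3\<close> to make these invertible.\<close>

lemma of_nat_mod_neq_0:
  assumes "of_nat q = (0::'a::{field})" "q mod m = 1"
  shows "of_nat m \<noteq> (0::'a)"
proof
  assume "of_nat m = (0::'a)"
  moreover have "(of_nat q :: 'a) = of_nat m * of_nat (q div m) + of_nat (q mod m)"
    by (metis mult_div_mod_eq of_nat_add of_nat_mult)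
  ultimately show False
    using assms by simp
qed

lemma odd_imp_two_neq_0:
  assumes "of_nat q = (0::'a::{field})" "odd q"
  shows "(2::'a) \<noteq> 0"
  using of_nat_mod_neq_0[OF assms(1), of 2] assms(2) by (simp add: odd_iff_mod_2_eq_one)

section \<open>Degree two: cases (a) to (f)\<close>

text \<open>For nonzero \<open>x\<close> the power is \<open>(x ^ q)\<^sup>2 / x\<close> with
  conjugate \<open>x\<^sup>2 / x ^ q\<close>; their sum is the fraction in
  \<open>quadratic_cube_trace_inj\<close>.\<close>

lemma inj_trace_2q_minus_1:
  fixes q :: nat and \<gamma> :: "'a::{field,finite}"
  assumes q: "primepow q" and card: "CARD('a) = q\<^sup>2"
    and two: "(2::'a) \<noteq> 0" and \<gamma>: "\<gamma> = - (1 / 3)" "\<gamma> \<noteq> 0"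
  shows "inj (\<lambda>x. x + \<gamma> * (x ^ (2 * q - 1) + (x ^ (2 * q - 1)) ^ q))"
proof (rule injI)
  fix x y :: 'a
  assume eq: "x + \<gamma> * (x ^ (2 * q - 1) + (x ^ (2 * q - 1)) ^ q) =
    y + \<gamma> * (y ^ (2 * q - 1) + (y ^ (2 * q - 1)) ^ q)"
  interpret field_endomorphism "\<lambda>x::'a. x ^ q"
    by (rule frobenius_endomorphism[OF q card])
  have inv: "(x ^ q) ^ q = x" for x :: 'a
    using finite_field_power_CARD[of x] by (simp add: card power2_eq_square power_mult)
  \<comment> \<open>If 3 were 0, then \<open>1 / 3\<close>, and with it \<gamma>, would be 0 by
    convention.\<close>
  have three: "(3::'a) \<noteq> 0"
    using \<gamma> by auto
  have "q > 0"
    using q by (rule primepow_gt_0_nat)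
  have tr: "x + \<gamma> * (x ^ (2 * q - 1) + (x ^ (2 * q - 1)) ^ q) =
      x - (x ^ 3 + (x ^ q) ^ 3) / (3 * (x * x ^ q))" for x :: 'a
  proof (cases "x = 0")
    case True
    then show ?thesis
      using \<open>q > 0\<close> by (simp add: power_0_left)
  next
    case False
    have "x ^ (2 * q - 1) * x = x ^ (2 * q)"
      using \<open>q > 0\<close> by (intro power_minus_mult) simp
    also have "\<dots> = (x ^ q)\<^sup>2"
      by (simp add: mult.commute flip: power_mult)
    finally have k: "x ^ (2 * q - 1) = (x ^ q)\<^sup>2 / x"
      using False by (simp add: eq_divide_eq)
    have kq: "((x ^ q)\<^sup>2 / x) ^ q = x\<^sup>2 / x ^ q"
      unfolding divide power[of "x ^ q" 2] inv ..
    have "a\<^sup>2 / z + z\<^sup>2 / a = (z ^ 3 + a ^ 3) / (z * a)" if "z \<noteq> 0" "a \<noteq> 0" for z a :: 'a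
      using that by (simp add: field_simps power2_eq_square power3_eq_cube)
    from this[of x "x ^ q"] False
    have "(x ^ q)\<^sup>2 / x + x\<^sup>2 / x ^ q = (x ^ 3 + (x ^ q) ^ 3) / (x * x ^ q)"
      by simp
    then show ?thesis
      unfolding k kq by (simp add: \<gamma>(1))
  qed
  show "x = y"
    by (rule quadratic_cube_trace_inj[OF inv two three]) (use eq in \<open>simp only: tr\<close>)
qed

text \<open>Here 3 divides \<open>2 * q - 1\<close>, so scaling by the cube root of unity
  \<open>w = - 3 * \<gamma>\<close> leaves \<open>z ^ k\<close> unchanged. Since \<gamma> is
  \<open>- (w / 3)\<close>, the map is that of case (a) conjugated by this scaling, up to the factor
  \<open>w\<close> that it shares with the argument.\<close>

lemma inj_trace_2q_minus_1_twisted: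
  fixes q :: nat and \<gamma> :: "'a::{field,finite}"
  assumes q: "primepow q" and card: "CARD('a) = q\<^sup>2"
    and two: "(2::'a) \<noteq> 0" and q5: "q mod 6 = 5" and \<gamma>: "\<gamma> ^ 3 = - (1 / 27)" "\<gamma> \<noteq> 0"
  shows "inj (\<lambda>x. x + \<gamma> * (x ^ (2 * q - 1) + (x ^ (2 * q - 1)) ^ q))"
proof (rule injI)
  fix x y :: 'a
  assume eq: "x + \<gamma> * (x ^ (2 * q - 1) + (x ^ (2 * q - 1)) ^ q) =
    y + \<gamma> * (y ^ (2 * q - 1) + (y ^ (2 * q - 1)) ^ q)"
  define k where "k = 2 * q - 1"
  define w where "w = - 3 * \<gamma>"
  have "(27::'a) \<noteq> 0"
    using \<gamma> by auto
  moreover have "(27::'a) = 3 * 9" by simp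
  ultimately have three: "(3::'a) \<noteq> 0"
    by (metis mult_zero_left)
  have "w ^ 3 = 1"
    using \<gamma>(1) \<open>(27::'a) \<noteq> 0\<close> by (simp add: w_def power_mult_distrib)
  have "w \<noteq> 0"
    using three \<gamma> by (simp add: w_def)
  obtain j where "q = 6 * j + 5"
    using q5 by (metis mult_div_mod_eq)
  then have "k = 3 * (4 * j + 3)"
    by (simp add: k_def)
  then have "w ^ k = 1"
    by (simp only: power_mult \<open>w ^ 3 = 1\<close> power_one)
  then have wk: "(w * z) ^ k = z ^ k" for z
    by (simp add: power_mult_distrib)
  have "\<gamma> = - (w / 3)"
    using three by (simp add: w_def)
  then have "z + \<gamma> * T = w * (z / w + (- (1 / 3)) * T)" for z T
    using \<open>w \<noteq> 0\<close> by (simp add: algebra_simps)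
  moreover have "z ^ k = (z / w) ^ k" for z
    using wk[of "z / w"] \<open>w \<noteq> 0\<close> by simp
  ultimately have "z + \<gamma> * (z ^ k + (z ^ k) ^ q) =
      w * (z / w + (- (1 / 3)) * ((z / w) ^ k + ((z / w) ^ k) ^ q))" for z
    by metis
  with eq \<open>w \<noteq> 0\<close> have "x / w + (- (1 / 3)) * ((x / w) ^ k + ((x / w) ^ k) ^ q) =
     y / w + (- (1 / 3)) * ((y / w) ^ k + ((y / w) ^ k) ^ q)"
    unfolding k_def[symmetric] by simp
  moreover have "- (1 / 3) \<noteq> (0::'a)"
    using three by simp
  ultimately have "x / w = y / w"
    using injD[OF inj_trace_2q_minus_1[OF q card two refl], of "x / w" "y / w"]
    unfolding k_def by blast
  with \<open>w \<noteq> 0\<close> show "x = y" by simp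
qed

text \<open>Case (c). Put \<open>w = (x ^ (q - 1)) ^ (m + 1)\<close>. Since
  \<open>3 * (m + 1) = (q + 1) + 1\<close> and \<open>x ^ (q - 1)\<close> has norm 1,
  \<open>w ^ 3 = x ^ (q - 1)\<close>. Hence \<open>x ^ k = x * w\<close> has conjugate
  \<open>x * w\<^sup>2\<close>, and \<open>f x ^ q = w * f x\<close> shows that a nonzero value
  determines \<open>w\<close>.\<close>

lemma inj_trace_cube_root_twist:
  fixes q m :: nat
  assumes q: "primepow q" and card: "CARD('a::{field,finite}) = q\<^sup>2" and m: "q = 3 * m + 1"
  shows "inj (\<lambda>x::'a. x + (x ^ (3 * m\<^sup>2 + 3 * m + 1) + (x ^ (3 * m\<^sup>2 + 3 * m + 1)) ^ q))"
proof (rule injI)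
  fix x y :: 'a
  define f where "f = (\<lambda>x::'a. x + (x ^ (3 * m\<^sup>2 + 3 * m + 1) + (x ^ (3 * m\<^sup>2 + 3 * m + 1)) ^ q))"
  assume "x + (x ^ (3 * m\<^sup>2 + 3 * m + 1) + (x ^ (3 * m\<^sup>2 + 3 * m + 1)) ^ q) =
    y + (y ^ (3 * m\<^sup>2 + 3 * m + 1) + (y ^ (3 * m\<^sup>2 + 3 * m + 1)) ^ q)"
  then have eq: "f x = f y"
    by (simp only: f_def)
  interpret field_endomorphism "\<lambda>x::'a. x ^ q"
    by (rule frobenius_endomorphism[OF q card])
  have inv: "(x ^ q) ^ q = x" for x :: 'a
    using finite_field_power_CARD[of x] by (simp add: card power2_eq_square power_mult)
  have "q > 0"
    using q by (rule primepow_gt_0_nat)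
  have three: "(3::'a) \<noteq> 0"
    using of_nat_mod_neq_0[OF frobenius_endomorphism(2)[OF q card], of 3] m by simp
  define w where "w = (\<lambda>x::'a. x ^ (3 * m * (m + 1)))"
  have *: "f x \<noteq> 0 \<and> f x ^ q = w x * f x \<and> 1 + w x + (w x)\<^sup>2 \<noteq> 0 \<and> f x = x * (1 + w x + (w x)\<^sup>2)"
    if "x \<noteq> 0" for x
  proof -
    have "x ^ (3 * m) * x = x ^ q"
      by (simp add: m)
    then have xm: "x ^ (3 * m) = x ^ q / x"
      using that by (simp add: eq_divide_eq)
    have unit: "(x ^ (3 * m)) ^ (q + 1) = 1"
      unfolding xm using that by (simp add: power_add divide inv)
    have w: "w x = (x ^ (3 * m)) ^ (m + 1)"
      by (simp only: w_def power_mult)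
    have w1: "w x ^ (q + 1) = 1"
      unfolding w using unit by (metis mult.commute power_mult power_one)
    have "(m + 1) * 3 = q + 1 + 1"
      by (simp add: m)
    then have "w x ^ 3 = (x ^ (3 * m)) ^ (q + 1 + 1)"
      unfolding w power_mult[symmetric, of _ "m + 1"] by (simp only:)
    also have "\<dots> = x ^ q / x"
      unfolding power_add[of "x ^ (3 * m)" "q + 1" 1] unit by (simp only: xm power_one_right mult_1_left)
    finally have w3: "x ^ q = x * w x ^ 3"
      using that by simp
    have wq: "w x * w x ^ q = 1" "w x \<noteq> 0"
      using w1 by auto
    have xk: "x ^ (3 * m\<^sup>2 + 3 * m + 1) = x * w x"
      by (simp add: w_def power2_eq_square algebra_simps)
    have xwq: "(x * w x) ^ q = x * (w x)\<^sup>2"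
      using wq by (simp add: mult w3 power2_eq_square power3_eq_cube mult.assoc)
    have f: "f x = x * (1 + w x + (w x)\<^sup>2)"
      unfolding f_def xk xwq by (simp add: algebra_simps)
    have "f x ^ q = x * w x ^ 3 * (1 + w x ^ q + (w x ^ q)\<^sup>2)"
      by (simp only: f mult add one power w3)
    also have "\<dots> = x * w x * ((w x)\<^sup>2 + w x * (w x * w x ^ q) + (w x * w x ^ q)\<^sup>2)"
      by (simp add: power2_eq_square power3_eq_cube algebra_simps)
    also have "\<dots> = w x * f x"
      unfolding wq f by (simp add: algebra_simps)
    finally have fq: "f x ^ q = w x * f x" .
    \<comment> \<open>A root would satisfy \<open>w ^ 3 = 1\<close>; together with
      \<open>w ^ (q + 1) = 1\<close> and \<open>3 * (m + 1) = q + 2\<close> this forces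
      \<open>w = 1\<close>, hence 3 = 0.\<close>
    have "1 + w x + (w x)\<^sup>2 \<noteq> 0"
    proof
      assume 0: "1 + w x + (w x)\<^sup>2 = 0"
      have "w x ^ 3 - 1 = (w x - 1) * (1 + w x + (w x)\<^sup>2)"
        by (simp add: power2_eq_square power3_eq_cube algebra_simps)
      with 0 have "w x ^ 3 = 1" by simp
      then have "w x ^ (3 * (m + 1)) = 1"
        by (simp only: power_mult power_one)
      also have "3 * (m + 1) = (q + 1) + 1"
        by (simp add: m)
      finally have "w x = 1"
        unfolding power_add[of "w x" "q + 1" 1] w1 by simp
      with 0 three show False by simp
    qed
    with f fq that show ?thesis by simp
  qed
  have f0: "f 0 = 0"
    using \<open>q > 0\<close> by (simp add: f_def power_0_left)
  show "x = y"
  proof (cases "x = 0 \<or> y = 0")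
    case True
    then show ?thesis using *[of x] *[of y] f0 eq by metis
  next
    case False
    then have "w x = w y"
      using *[of x] *[of y] eq by auto
    then have "x * (1 + w y + (w y)\<^sup>2) = y * (1 + w y + (w y)\<^sup>2)"
      using *[of x] *[of y] eq False by metis
    then show ?thesis
      using *[of y] False by simp
  qed
qed

text \<open>
  Let \<open>h = (q + 1) / 2\<close>. Off the set of \<open>z\<close> with \<open>z ^ h\<close> in the subfield of order \<open>q\<close> the trace
  vanishes; on this set \<open>z = 2 \<gamma> v s\<close> with \<open>v\<close> in the subfield and \<open>s ^ h = 1\<close>, and \<open>z\<close> is mapped to
  \<open>2 \<gamma> v (s + 1)\<close>, from which \<open>s\<close> and \<open>v\<close> can be read off.
\<close>
lemma inj_trace_half_norm_square:
  fixes q j :: nat and \<gamma> :: "'a::{field,finite}"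
  assumes q: "primepow q" and card: "CARD('a) = q\<^sup>2" and j: "q = 4 * j + 1"
    and \<gamma>: "(2 * \<gamma>) ^ (2 * j + 1) = 1"
  shows "inj (\<lambda>x. x + \<gamma> * (x ^ (2 * j + 1)\<^sup>2 + (x ^ (2 * j + 1)\<^sup>2) ^ q))"
proof (rule injI)
  fix x y :: 'a
  define h \<beta> where "h = 2 * j + 1" and "\<beta> = 2 * \<gamma>"
  define f where "f = (\<lambda>x::'a. x + \<gamma> * (x ^ h\<^sup>2 + (x ^ h\<^sup>2) ^ q))"
  assume "x + \<gamma> * (x ^ (2 * j + 1)\<^sup>2 + (x ^ (2 * j + 1)\<^sup>2) ^ q) =
    y + \<gamma> * (y ^ (2 * j + 1)\<^sup>2 + (y ^ (2 * j + 1)\<^sup>2) ^ q)"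
  then have eq: "f x = f y"
    by (simp only: f_def h_def)
  interpret field_endomorphism "\<lambda>x::'a. x ^ q"
    by (rule frobenius_endomorphism[OF q card])
  have inv: "(x ^ q) ^ q = x" for x :: 'a
    using finite_field_power_CARD[of x] by (simp add: card power2_eq_square power_mult)
  have two: "(2::'a) \<noteq> 0"
    by (rule odd_imp_two_neq_0[OF frobenius_endomorphism(2)[OF q card]]) (simp add: j)
  have swap: "(z ^ a) ^ b = (z ^ b) ^ a" for z :: 'a and a b :: nat
    by (metis mult.commute power_mult)
  have h2: "h * 2 = q + 1" and "odd h" and hh: "h\<^sup>2 = 1 + 4 * j * (j + 1)"
    by (simp_all add: h_def j power2_eq_square algebra_simps)
  have \<beta>: "\<beta> ^ h = 1" "\<beta> \<noteq> 0"
    using \<gamma> by (auto simp: h_def \<beta>_def)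
  have h2': "(z ^ h)\<^sup>2 = z * z ^ q" for z :: 'a
    by (simp add: h2 flip: power_mult)
  \<comment> \<open>The square of \<open>z ^ h\<close> is the norm of \<open>z\<close>, which is
    fixed by the Frobenius map.\<close>
  have dich: "(z ^ h) ^ q = z ^ h \<or> (z ^ h) ^ q = - (z ^ h)" for z :: 'a
  proof -
    have "((z ^ h) ^ q)\<^sup>2 = (z ^ h)\<^sup>2"
      unfolding swap[of "z ^ h" q] h2' by (simp add: mult inv)
    then show ?thesis
      by (rule power2_eq_iff[THEN iffD1])
  qed
  have outside: "f z = z" if "(z ^ h) ^ q = - (z ^ h)" for z
  proof -
    have "(z ^ h\<^sup>2) ^ q = ((z ^ h) ^ q) ^ h"
      by (metis power2_eq_square power_mult swap)
    also have "\<dots> = - (z ^ h\<^sup>2)"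
      unfolding that using \<open>odd h\<close> by (simp add: power2_eq_square power_mult)
    finally show ?thesis
      by (simp add: f_def)
  qed
  have inside: "\<exists>s v. s \<noteq> 0 \<and> f z = \<beta> * v * (s + 1) \<and> f z \<noteq> 0 \<and> z = \<beta> * v * s \<and>
      (f z) ^ q * (\<beta> * s) = f z * \<beta> ^ q \<and> (f z ^ h) ^ q = f z ^ h"
    if "(z ^ h) ^ q = z ^ h" "z \<noteq> 0" for z
  proof -
    \<comment> \<open>Here \<open>v\<close> equals \<open>z ^ h\<^sup>2\<close>. As
      \<open>h\<^sup>2 = 1 + (q - 1) * (j + 1)\<close> and \<open>u\<close> lies in the subfield,
      \<open>v ^ h = u\<close>; with \<open>\<beta> ^ h = 1\<close> this yields
      \<open>s ^ h = 1\<close>.\<close>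
    define u v s where "u = z ^ h" and "v = u ^ h" and "s = z / (\<beta> * v)"
    have nz: "u \<noteq> 0" "v \<noteq> 0" "s \<noteq> 0"
      using that(2) \<beta> by (simp_all add: u_def v_def s_def)
    have uq: "u ^ q = u"
      using that(1) by (simp add: u_def)
    have vq: "v ^ q = v"
      by (simp add: v_def uq swap[of u h q])
    have "u ^ (4 * j) * u = u"
      using uq by (simp add: j)
    then have u1: "u ^ (4 * j) = 1"
      using nz by simp
    have "v ^ h = u ^ (1 + 4 * j * (j + 1))"
      unfolding v_def hh[symmetric] by (simp add: power2_eq_square power_mult)
    also have "\<dots> = u"
      unfolding power_add power_mult[of u "4 * j" "j + 1"] u1 by simp
    finally have "v ^ h = u" .
    then have sh: "s ^ h = 1"
      using nz \<beta> by (simp add: s_def power_divide power_mult_distrib flip: u_def)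
    then have "s * s ^ q = 1"
      using h2'[of s] by simp
    then have sq: "s ^ q = 1 / s"
      using nz by (simp add: eq_divide_eq mult.commute)
    have "s \<noteq> - 1"
      using sh \<open>odd h\<close> two eq_minus_imp_eq_0[OF two, of "1::'a"] by auto
    have z: "z = \<beta> * v * s"
      using nz \<beta> by (simp add: s_def)
    have zv: "z ^ h\<^sup>2 = v"
      by (simp add: v_def u_def power2_eq_square power_mult)
    have "f z = z + \<beta> * v"
      unfolding f_def zv vq by (simp add: \<beta>_def algebra_simps)
    then have f: "f z = \<beta> * v * (s + 1)"
      using z by (simp add: algebra_simps)
    have "s + 1 \<noteq> 0"
      using \<open>s \<noteq> - 1\<close> by (simp add: eq_neg_iff_add_eq_0)
    then have "f z \<noteq> 0"
      using f nz \<beta> by simp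
    have s1: "(s + 1) ^ q = (s + 1) / s"
      using nz by (simp add: hom sq field_simps)
    have "(f z) ^ q * (\<beta> * s) = f z * \<beta> ^ q"
      unfolding f mult vq s1 using nz by (simp add: field_simps)
    moreover have "(f z ^ h) ^ q = f z ^ h"
    proof -
      have "((s + 1) ^ h) ^ q = (s + 1) ^ h"
        unfolding swap[of "s + 1" h q] s1 power_divide sh by simp
      then show ?thesis
        unfolding f power_mult_distrib \<beta>(1) \<open>v ^ h = u\<close> by (simp add: power_mult_distrib uq)
    qed
    ultimately show ?thesis
      using f \<open>f z \<noteq> 0\<close> z nz by blast
  qed
  have "h > 0"
    by (simp add: h_def)
  then have f0: "f 0 = 0"
    using primepow_gt_0_nat[OF q] by (simp add: f_def power_0_left)
  \<comment> \<open>Values at points inside the set stay inside, while outside points are fixed by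
    \<open>f\<close>, so the two images are disjoint.\<close>
  have mixed: "\<not> (f x = f y \<and> (x ^ h) ^ q = x ^ h \<and> (y ^ h) ^ q \<noteq> y ^ h)" for x y
  proof
    assume *: "f x = f y \<and> (x ^ h) ^ q = x ^ h \<and> (y ^ h) ^ q \<noteq> y ^ h"
    then have "f y = y"
      using dich outside by metis
    with * inside[of x] f0 have "(y ^ h) ^ q = y ^ h"
      by (cases "x = 0") auto
    with * show False by simp
  qed
  show "x = y"
  proof (cases "(x ^ h) ^ q = x ^ h")
    case False
    then show ?thesis
      using mixed[of y x] eq dich outside by metis
  next
    case True
    then have True': "(y ^ h) ^ q = y ^ h"
      using mixed[of x y] eq by simp
    show ?thesis
    proof (cases "x = 0 \<or> y = 0")
      case True
      then show ?thesis
        using inside[OF \<open>(x ^ h) ^ q = x ^ h\<close>] inside[OF True'] f0 eq by metis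
    next
      case False
      obtain s v where x: "f x = \<beta> * v * (s + 1)" "f x \<noteq> 0" "x = \<beta> * v * s"
          "(f x) ^ q * (\<beta> * s) = f x * \<beta> ^ q"
        using inside[OF True] False by metis
      obtain s' v' where y: "f y = \<beta> * v' * (s' + 1)" "y = \<beta> * v' * s'"
          "(f y) ^ q * (\<beta> * s') = f y * \<beta> ^ q"
        using inside[OF True'] False by metis
      have "f y ^ q * (\<beta> * s) = f y ^ q * (\<beta> * s')"
        using x(4) y(3) by (simp add: eq)
      then have "s = s'"
        using x(2) \<beta> by (simp add: eq)
      moreover from this have "v = v'"
        using x(1,2) y(1) \<beta> eq by auto
      ultimately show ?thesis
        using x(3) y(2) by simp
    qed
  qed
qed

text \<open>The map \<open>e\<close> is the \<open>Q\<close>-th power in case (e) and its inverse in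
  case (f). Both square to the \<open>q\<close>-th power, which swaps the two fractions, so
  \<open>x ^ k\<close> may be either of them.\<close>

lemma inj_trace_quartic:
  fixes Q k :: nat and e :: "'a::field \<Rightarrow> 'a"
  assumes "Q > 0" and "k > 0" and two: "(2::'a) \<noteq> 0"
    and endo: "field_endomorphism e" and inv: "\<And>x. e (e (e (e x))) = x" and e2: "\<And>x. e (e x) = x ^ Q\<^sup>2"
    and k: "\<And>x. x \<noteq> 0 \<Longrightarrow> x ^ k = x * e (e (e x)) / e x \<or> x ^ k = e x * e (e x) / e (e (e x))"
  shows "inj (\<lambda>x::'a. x - (x ^ k + (x ^ k) ^ Q\<^sup>2))"
proof (rule injI)
  fix x y :: 'a
  interpret field_endomorphism e by (rule endo)
  assume eq: "x - (x ^ k + (x ^ k) ^ Q\<^sup>2) = y - (y ^ k + (y ^ k) ^ Q\<^sup>2)"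
  have tr: "x ^ k + (x ^ k) ^ Q\<^sup>2 = x * e (e (e x)) / e x + e x * e (e x) / e (e (e x))" for x
  proof (cases "x = 0")
    case True
    then show ?thesis
      using \<open>k > 0\<close> \<open>Q > 0\<close> by (simp add: zero power_0_left)
  next
    case False
    from k[OF this] show ?thesis
    proof
      assume *: "x ^ k = x * e (e (e x)) / e x"
      show ?thesis
        unfolding e2[of "x ^ k", symmetric] unfolding * by (simp only: hom inv mult.commute)
    next
      assume *: "x ^ k = e x * e (e x) / e (e (e x))"
      show ?thesis
        unfolding e2[of "x ^ k", symmetric] unfolding * by (simp only: hom inv mult.commute add.commute)
    qed
  qed
  show "x = y"
    by (rule quartic_trace_inj[OF inv two refl]) (use eq in \<open>simp only: tr\<close>)
qed

section \<open>Degree three: cases (g) and (h)\<close>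

text \<open>Write \<open>x = c * z\<^sup>2\<close> with \<open>c\<close> in the subfield. Then
  \<open>c ^ k = c\<close>, because \<open>k\<close> is 1 modulo \<open>q - 1\<close>, and
  \<open>(z\<^sup>2) ^ k = z * (z ^ q) ^ q\<close>, because \<open>2 * k = 1 + q * q\<close>. The
  value therefore factors as in \<open>cubic_norm_form_inj\<close>.\<close>

lemma inj_trace_cubic_half:
  fixes q j :: nat
  assumes q: "primepow q" and card: "CARD('a::{field,finite}) = q ^ 3" and j: "q = 2 * j + 1"
  shows "inj (\<lambda>x::'a. x + (x ^ (2 * j * (j + 1) + 1) + (x ^ (2 * j * (j + 1) + 1)) ^ q
    + ((x ^ (2 * j * (j + 1) + 1)) ^ q) ^ q))"
proof (rule injI)
  fix x y :: 'a
  define k where "k = 2 * j * (j + 1) + 1"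
  define f where "f = (\<lambda>x::'a. x + (x ^ k + (x ^ k) ^ q + ((x ^ k) ^ q) ^ q))"
  interpret field_endomorphism "\<lambda>x::'a. x ^ q"
    by (rule frobenius_endomorphism[OF q card])
  have inv: "((x ^ q) ^ q) ^ q = x" for x :: 'a
    using finite_field_power_CARD[of x] by (simp add: card power3_eq_cube power_mult)
  have two: "(2::'a) \<noteq> 0"
    by (rule odd_imp_two_neq_0[OF frobenius_endomorphism(2)[OF q card]]) (simp add: j)
  assume "x + (x ^ (2 * j * (j + 1) + 1) + (x ^ (2 * j * (j + 1) + 1)) ^ q
    + ((x ^ (2 * j * (j + 1) + 1)) ^ q) ^ q) = y + (y ^ (2 * j * (j + 1) + 1) + (y ^ (2 * j * (j + 1) + 1)) ^ q
    + ((y ^ (2 * j * (j + 1) + 1)) ^ q) ^ q)"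
  then have eq: "f x = f y"
    by (simp only: f_def k_def)
  have repr: "\<exists>c z. c \<noteq> 0 \<and> c ^ q = c \<and> x = c * z\<^sup>2 \<and> f x = c * ((z + z ^ q) * (z + (z ^ q) ^ q))"
    for x
  proof (cases "x = 0")
    case True
    then show ?thesis
      using primepow_gt_0_nat[OF q]
      by (intro exI[of _ 1] exI[of _ 0]) (simp add: f_def k_def power_0_left)
  next
    case False
    \<comment> \<open>The norm of \<open>x\<close> serves as \<open>c\<close>; then
      \<open>x / c\<close> is the inverse of \<open>x ^ (q + q * q)\<close>, whose exponent is
      even.\<close>
    define c z where "c = x * x ^ q * (x ^ q) ^ q" and "z = 1 / (x ^ ((j + 1) * q))"
    have "c \<noteq> 0"
      using False by (simp add: c_def)
    have cq: "c ^ q = c"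
      by (simp add: c_def power_mult_distrib inv mult_ac)
    have "(j + 1) * q * 2 = q + q * q"
      by (simp add: j algebra_simps)
    then have "(x ^ ((j + 1) * q))\<^sup>2 = x ^ (q + q * q)"
      unfolding power_mult[symmetric] by (simp only:)
    also have "\<dots> = x ^ q * (x ^ q) ^ q"
      by (simp add: power_add power_mult)
    finally have x: "x = c * z\<^sup>2"
      using False by (simp add: c_def z_def power_divide)
    have "c ^ (2 * j) * c = c"
      using cq by (simp add: j)
    then have c1: "c ^ (2 * j) = 1"
      using \<open>c \<noteq> 0\<close> by simp
    have ck: "c ^ k = c"
      unfolding k_def power_add power_mult[of c "2 * j" "j + 1"] c1 by simp
    have "2 * k = 1 + q * q"
      by (simp add: k_def j algebra_simps)
    then have "(z\<^sup>2) ^ k = z * (z ^ q) ^ q"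
      by (simp add: power_add flip: power_mult)
    then have xk: "x ^ k = c * (z * (z ^ q) ^ q)"
      unfolding x power_mult_distrib ck by simp
    have "f x = c * ((z + z ^ q) * (z + (z ^ q) ^ q))"
      unfolding f_def xk by (simp add: mult cq inv) (simp add: x power2_eq_square algebra_simps)
    with x cq \<open>c \<noteq> 0\<close> show ?thesis by blast
  qed
  obtain c z where x: "c \<noteq> 0" "c ^ q = c" "x = c * z\<^sup>2" "f x = c * ((z + z ^ q) * (z + (z ^ q) ^ q))"
    using repr[of x] by blast
  obtain d w where y: "d \<noteq> 0" "d ^ q = d" "y = d * w\<^sup>2" "f y = d * ((w + w ^ q) * (w + (w ^ q) ^ q))"
    using repr[of y] by blast
  show "x = y"
    unfolding x(3) y(3) using inv two x(2,1) y(2,1)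
    by (rule cubic_norm_form_inj) (use eq x y in simp)
qed

lemma inj_trace_cubic_doubling:
  fixes q :: nat
  assumes q: "primepow q" and card: "CARD('a::{field,finite}) = q ^ 3" and two: "(2::'a) \<noteq> 0"
  shows "inj (\<lambda>x::'a. x - (x ^ (q\<^sup>2 - q + 1) + (x ^ (q\<^sup>2 - q + 1)) ^ q
    + ((x ^ (q\<^sup>2 - q + 1)) ^ q) ^ q) / 2)"
proof (rule injI)
  fix x y :: 'a
  define k where "k = q\<^sup>2 - q + 1"
  interpret field_endomorphism "\<lambda>x::'a. x ^ q"
    by (rule frobenius_endomorphism[OF q card])
  have inv: "((x ^ q) ^ q) ^ q = x" for x :: 'a
    using finite_field_power_CARD[of x] by (simp add: card power3_eq_cube power_mult)
  assume eq: "x - (x ^ (q\<^sup>2 - q + 1) + (x ^ (q\<^sup>2 - q + 1)) ^ q + ((x ^ (q\<^sup>2 - q + 1)) ^ q) ^ q) / 2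
    = y - (y ^ (q\<^sup>2 - q + 1) + (y ^ (q\<^sup>2 - q + 1)) ^ q + ((y ^ (q\<^sup>2 - q + 1)) ^ q) ^ q) / 2"
  have tr: "x ^ k + (x ^ k) ^ q + ((x ^ k) ^ q) ^ q =
      x * (x ^ q) ^ q / x ^ q + x ^ q * x / (x ^ q) ^ q + (x ^ q) ^ q * x ^ q / x" for x :: 'a
  proof (cases "x = 0")
    case True
    then show ?thesis
      using primepow_gt_0_nat[OF q] by (simp add: k_def power_0_left)
  next
    case False
    have "k + q = 1 + q * q"
      using le_square[of q] by (simp add: k_def power2_eq_square)
    then have "x ^ k * x ^ q = x * (x ^ q) ^ q"
      by (simp flip: power_add power_mult power_Suc)
    then have xk: "x ^ k = x * (x ^ q) ^ q / x ^ q"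
      using False by (simp add: eq_divide_eq)
    show ?thesis
      unfolding xk by (simp only: mult divide inv)
  qed
  show "x = y"
    by (rule cubic_trace_inj[OF inv two refl]) (use eq in \<open>simp only: tr flip: k_def\<close>)
qed

section \<open>The trace of a quadratic form: case (i)\<close>

text \<open>Adjacent blocks of length \<open>l\<close> cancel, and there are \<open>2 * r\<close> of
  them.\<close>

lemma sum_antiperiodic_eq_0:
  fixes a :: "nat \<Rightarrow> 'a::ab_group_add"
  assumes "\<And>i. a (i + l) = - a i"
  shows "(\<Sum>i<2 * l * r. a i) = 0"
proof -
  have shift: "(\<Sum>i<m + l. a i) = (\<Sum>i<l. a i) - (\<Sum>i<m. a i)" for m
    by (induction m) (simp_all add: assms algebra_simps)
  show ?thesis
  proof (induction r)
    case (Suc r)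
    have "2 * l * Suc r = (2 * l * r + l) + l"
      by simp
    then show ?case
      using Suc by (simp only: shift) simp
  qed simp
qed

text \<open>With \<open>x = y + \<gamma> * t\<close> and \<open>t\<close> in the subfield,
  \<open>x ^ k - y ^ k\<close> has a part linear in \<open>t\<close> and a part
  \<open>t\<^sup>2 * \<delta>\<close>. The \<open>q ^ (2 * l)\<close>-th power negates \<gamma>.
  Hence the two summands of the linear part have opposite traces, and the conjugates of \<delta> are
  antiperiodic with trace 0.\<close>

lemma inj_trace_trace_quadratic:
  fixes q n l r :: nat and \<gamma> :: "'a::{field,finite}"
  assumes q: "primepow q" and card: "CARD('a) = q ^ n" and n: "n = 2 * l * r"
    and \<gamma>: "\<gamma> ^ (q ^ (2 * l) - 1) = - 1"
  shows "inj (\<lambda>x. x + \<gamma> * (\<Sum>i<n. (x ^ (q ^ l + 1)) ^ q ^ i))"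
proof (rule injI)
  fix x y :: 'a
  interpret field_endomorphism "\<lambda>x::'a. x ^ q"
    by (rule frobenius_endomorphism[OF q card])
  define Tr where "Tr = (\<lambda>z::'a. \<Sum>i<n. z ^ q ^ i)"
  define k where "k = q ^ l + 1"
  define t where "t = Tr (y ^ k) - Tr (x ^ k)"
  have frob: "field_endomorphism (\<lambda>x::'a. x ^ q ^ i)" for i
  proof (induction i)
    case (Suc i)
    then interpret i: field_endomorphism "\<lambda>x::'a. x ^ q ^ i" .
    show ?case
      by standard (simp_all add: power_mult add mult i.add i.mult)
  qed (standard, simp_all)
  have Tr_add: "Tr (u + v) = Tr u + Tr v" for u v
    by (simp add: Tr_def field_endomorphism.add[OF frob] sum.distrib)
  have Tr_scale: "Tr (c * u) = c * Tr u" if "c ^ q = c" for c u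
  proof -
    have "c ^ q ^ i = c" for i
      by (induction i) (simp_all add: power_mult that)
    then show ?thesis
      by (simp add: Tr_def power_mult_distrib sum_distrib_left)
  qed
  have Tr_shift: "Tr (u ^ q) = Tr u" for u
  proof -
    \<comment> \<open>Splitting off the first or the last of \<open>n + 1\<close> conjugates gives
      the same sum, and both split terms equal \<open>u\<close>.\<close>
    have "(\<Sum>i<Suc n. u ^ q ^ i) = u + Tr (u ^ q)"
      unfolding sum.lessThan_Suc_shift by (simp add: Tr_def power_mult)
    then have "Tr u + u ^ q ^ n = u + Tr (u ^ q)"
      by (simp add: Tr_def)
    then show ?thesis
      using finite_field_power_CARD[of u] by (simp add: card)
  qed
  have Tr_shift_pow: "Tr (u ^ q ^ i) = Tr u" for u i
  proof (induction i)
    case (Suc i)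
    have "u ^ q ^ Suc i = (u ^ q ^ i) ^ q"
      by (simp add: mult.commute flip: power_mult)
    then show ?case
      using Suc by (simp add: Tr_shift)
  qed simp
  have Tr_fixed: "Tr u ^ q = Tr u" for u
  proof -
    have "(\<Sum>i<m. u ^ q ^ i) ^ q = (\<Sum>i<m. (u ^ q) ^ q ^ i)" for m
    proof (induction m)
      case (Suc m)
      then show ?case
        by (simp add: add) (metis mult.commute power_mult)
    qed (simp add: zero)
    then show ?thesis
      using Tr_shift by (simp add: Tr_def)
  qed
  have "t ^ q = t"
    by (simp add: t_def diff Tr_fixed)
  have tl: "t ^ q ^ l = t"
    by (induction l) (simp_all add: power_mult \<open>t ^ q = t\<close>)
  interpret l: field_endomorphism "\<lambda>x::'a. x ^ q ^ l"
    by (rule frob)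
  have "q > 0"
    using q by (rule primepow_gt_0_nat)
  then have "\<gamma> ^ q ^ (2 * l) = - \<gamma>"
    using power_minus_mult[of "q ^ (2 * l)" \<gamma>] \<gamma> by simp
  then have \<gamma>2: "(\<gamma> ^ q ^ l) ^ q ^ l = - \<gamma>"
    by (simp add: mult_2 power_add power_mult)
  define \<delta> where "\<delta> = \<gamma> * \<gamma> ^ q ^ l"
  have "\<delta> ^ q ^ l = - \<delta>"
    by (simp add: \<delta>_def power_mult_distrib \<gamma>2)
  have "Tr \<delta> = 0"
    unfolding Tr_def n
  proof (rule sum_antiperiodic_eq_0)
    fix i
    interpret i: field_endomorphism "\<lambda>x::'a. x ^ q ^ i"
      by (rule frob)
    have "\<delta> ^ q ^ (i + l) = (\<delta> ^ q ^ l) ^ q ^ i"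
      by (simp add: power_add mult.commute flip: power_mult)
    then show "\<delta> ^ q ^ (i + l) = - (\<delta> ^ q ^ i)"
      by (simp add: \<open>\<delta> ^ q ^ l = - \<delta>\<close> i.minus)
  qed
  have "Tr (- u) = - Tr u" for u
    using Tr_scale[of "- 1" u] minus[of 1] by simp
  then have "Tr (y * \<gamma> ^ q ^ l) = - Tr (\<gamma> * y ^ q ^ l)"
    using Tr_shift_pow[of "y * \<gamma> ^ q ^ l" l] by (simp add: power_mult_distrib \<gamma>2 mult.commute)
  then have cross: "Tr (y * \<gamma> ^ q ^ l) + Tr (\<gamma> * y ^ q ^ l) = 0"
    by simp
  assume "x + \<gamma> * (\<Sum>i<n. (x ^ (q ^ l + 1)) ^ q ^ i) = y + \<gamma> * (\<Sum>i<n. (y ^ (q ^ l + 1)) ^ q ^ i)"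
  then have "x + \<gamma> * Tr (x ^ k) = y + \<gamma> * Tr (y ^ k)"
    by (simp only: Tr_def k_def)
  then have x: "x = y + \<gamma> * t"
    by (simp add: t_def algebra_simps)
  have "x ^ k = x * x ^ q ^ l"
    by (simp add: k_def)
  also have "\<dots> = y ^ k + t * ((y * \<gamma> ^ q ^ l + \<gamma> * y ^ q ^ l) + t * \<delta>)"
    unfolding x l.add l.mult tl \<delta>_def k_def by (simp add: algebra_simps)
  finally have "Tr (x ^ k) = Tr (y ^ k)"
    by (simp only: Tr_add Tr_scale[OF \<open>t ^ q = t\<close>] cross \<open>Tr \<delta> = 0\<close>) simp
  then have "t = 0"
    by (simp only: t_def diff_self)
  with x show "x = y"
    by simp
qed

section \<open>Reduction of the nine cases to injectivity\<close>

theorem theorem1p1: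
  fixes q n k :: nat and \<gamma> :: "'a::{field,finite}"
  assumes "primepow q" and "n > 0" and "k > 0"
    and "CARD('a) = q ^ n" and "\<gamma> \<noteq> 0"
    and "(n = 2 \<and> ([int q = 1] (mod 6) \<or> [int q = -1] (mod 6)) \<and> \<gamma> = - (1 / 3) \<and> k = 2 * q - 1)
       \<or> (n = 2 \<and> [q = 5] (mod 6) \<and> \<gamma> ^ 3 = - (1 / 27) \<and> k = 2 * q - 1)
       \<or> (n = 2 \<and> [q = 1] (mod 3) \<and> \<gamma> = 1 \<and> k = (q ^ 2 + q + 1) div 3)
       \<or> (n = 2 \<and> [q = 1] (mod 4) \<and> (2 * \<gamma>) ^ ((q + 1) div 2) = 1 \<and> k = (q + 1) ^ 2 div 4)
       \<or> (n = 2 \<and> (\<exists>Q::nat. primepow Q \<and> Q > 0 \<and> odd Q \<and> q = Q ^ 2 \<and> \<gamma> = -1 \<and> k = Q ^ 3 - Q + 1))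
       \<or> (n = 2 \<and> (\<exists>Q::nat. primepow Q \<and> Q > 0 \<and> odd Q \<and> q = Q ^ 2 \<and> \<gamma> = -1 \<and> k = Q ^ 3 + Q ^ 2 - Q))
       \<or> (n = 3 \<and> odd q \<and> \<gamma> = 1 \<and> k = (q ^ 2 + 1) div 2)
       \<or> (n = 3 \<and> odd q \<and> \<gamma> = - (1 / 2) \<and> k = q ^ 2 - q + 1)
       \<or> (\<exists>l r::nat. l > 0 \<and> r > 0 \<and> n = 2 * l * r \<and> \<gamma> ^ (q ^ (2 * l) - 1) = -1 \<and> k = q ^ l + 1)"
  shows "permutation_poly ([:0, 1:] + smult \<gamma> (pcompose (trace_poly q n) (monom 1 k)))"
proof -
  let ?f = "\<lambda>x::'a. x + \<gamma> * (\<Sum>i<n. (x ^ k) ^ q ^ i)"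
  note q = assms(1) and card = assms(4)
  have q0: "of_nat q = (0::'a)"
    using frobenius_endomorphism(2)[OF q card] .
  note two = odd_imp_two_neq_0[OF q0]
  have sum2: "(\<Sum>i<2. z ^ q ^ i) = z + z ^ q" for z :: 'a
    by (simp add: numeral_2_eq_2)
  have sum3: "(\<Sum>i<3. z ^ q ^ i) = z + z ^ q + (z ^ q) ^ q" for z :: 'a
    by (simp add: numeral_3_eq_3 power_mult)
  have quartic: "inj ?f" if n: "n = 2" and Q: "primepow Q" "odd Q" "q = Q\<^sup>2" and \<gamma>: "\<gamma> = - 1"
    and k: "k = Q ^ 3 - Q + 1 \<or> k = Q ^ 3 + Q\<^sup>2 - Q" for Q
  proof -
    have card': "CARD('a) = Q ^ 4"
      using card by (simp add: n Q flip: power_mult)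
    interpret Q: field_endomorphism "\<lambda>x::'a. x ^ Q"
      by (rule frobenius_endomorphism[OF Q(1) card'])
    have inv: "(((x ^ Q) ^ Q) ^ Q) ^ Q = x" for x :: 'a
      using finite_field_power_CARD[of x] by (simp add: card' numeral_eq_Suc power_mult)
    have Q2: "(x ^ Q) ^ Q = x ^ Q\<^sup>2" for x :: 'a
      by (simp add: power2_eq_square power_mult)
    have two: "(2::'a) \<noteq> 0"
      using two Q by simp
    have Q3: "x ^ Q ^ 3 = ((x ^ Q) ^ Q) ^ Q" for x :: 'a
      by (simp add: power3_eq_cube power_mult)
    have "Q \<le> Q ^ 3"
      using primepow_gt_0_nat[OF Q(1)] by (intro self_le_power) simp_all
    from k have "inj (\<lambda>x::'a. x - (x ^ k + (x ^ k) ^ Q\<^sup>2))"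
    proof
      assume k: "k = Q ^ 3 - Q + 1"
      show ?thesis
      proof (rule inj_trace_quartic[OF primepow_gt_0_nat[OF Q(1)] assms(3) two Q.field_endomorphism_axioms inv Q2],
          rule disjI1)
        fix x :: 'a assume "x \<noteq> 0"
        have "k + Q = 1 + Q ^ 3"
          using \<open>Q \<le> Q ^ 3\<close> by (simp add: k)
        then have "x ^ k * x ^ Q = x * x ^ Q ^ 3"
          by (simp flip: power_add power_Suc)
        then show "x ^ k = x * ((x ^ Q) ^ Q) ^ Q / x ^ Q"
          using \<open>x \<noteq> 0\<close> by (simp add: eq_divide_eq Q3)
      qed
    next
      assume k: "k = Q ^ 3 + Q\<^sup>2 - Q"
      \<comment> \<open>This is the inverse of the \<open>Q\<close>-th power map; by
        \<open>inv\<close>, its square is the \<open>Q\<^sup>2\<close>-th power and its cube the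
        \<open>Q\<close>-th power.\<close>
      let ?e = "\<lambda>x::'a. ((x ^ Q) ^ Q) ^ Q"
      have endo: "field_endomorphism ?e"
        by standard (simp_all add: Q.add Q.mult)
      show ?thesis
      proof (rule inj_trace_quartic[OF primepow_gt_0_nat[OF Q(1)] assms(3) two endo],
          unfold inv, rule refl, rule Q2, rule disjI2)
        fix x :: 'a assume "x \<noteq> 0"
        have "k + Q = Q ^ 3 + Q\<^sup>2"
          using \<open>Q \<le> Q ^ 3\<close> by (simp add: k)
        then have "x ^ k * x ^ Q = x ^ Q ^ 3 * x ^ Q\<^sup>2"
          by (simp flip: power_add)
        then show "x ^ k = ((x ^ Q) ^ Q) ^ Q * (x ^ Q) ^ Q / x ^ Q"
          using \<open>x \<noteq> 0\<close> by (simp add: eq_divide_eq Q3 Q2)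
      qed
    qed
    then show ?thesis
      unfolding n sum2 unfolding \<gamma> Q(3) by (simp add: algebra_simps)
  qed
  have "inj ?f"
    using assms(6)
  proof (elim disjE)
    assume *: "n = 2 \<and> ([int q = 1] (mod 6) \<or> [int q = -1] (mod 6)) \<and> \<gamma> = - (1 / 3) \<and> k = 2 * q - 1"
    then have "int q mod 6 = 1 \<or> int q mod 6 = 5"
      by (simp add: cong_def)
    then have "odd q"
      by presburger
    then show ?thesis
      using inj_trace_2q_minus_1[OF q _ two, of \<gamma>] * card assms(5) by (simp add: sum2)
  next
    assume *: "n = 2 \<and> [q = 5] (mod 6) \<and> \<gamma> ^ 3 = - (1 / 27) \<and> k = 2 * q - 1"
    then have "q mod 6 = 5"
      by (simp add: cong_def)
    then have "odd q"
      by presburger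
    then show ?thesis
      using inj_trace_2q_minus_1_twisted[OF q _ two \<open>q mod 6 = 5\<close>, of \<gamma>] * card assms(5) by (simp add: sum2)
  next
    assume *: "n = 2 \<and> [q = 1] (mod 3) \<and> \<gamma> = 1 \<and> k = (q ^ 2 + q + 1) div 3"
    then have "q mod 3 = 1"
      by (simp add: cong_def)
    then obtain m where m: "q = 3 * m + 1"
      by (metis mult_div_mod_eq)
    have "q ^ 2 + q + 1 = 3 * (3 * m\<^sup>2 + 3 * m + 1)"
      by (simp add: m power2_eq_square algebra_simps)
    then have k: "k = 3 * m\<^sup>2 + 3 * m + 1"
      using * by simp
    have "CARD('a) = q\<^sup>2" "n = 2" "\<gamma> = 1"
      using * card by simp_all
    with inj_trace_cube_root_twist[OF q _ m, where 'a = 'a] show ?thesis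
      by (simp only: sum2 flip: k) simp
  next
    assume *: "n = 2 \<and> [q = 1] (mod 4) \<and> (2 * \<gamma>) ^ ((q + 1) div 2) = 1 \<and> k = (q + 1) ^ 2 div 4"
    then have "q mod 4 = 1"
      by (simp add: cong_def)
    then obtain j where j: "q = 4 * j + 1"
      by (metis mult_div_mod_eq)
    have "(q + 1) ^ 2 = 4 * (2 * j + 1)\<^sup>2" and h: "(q + 1) div 2 = 2 * j + 1"
      by (simp_all add: j power2_eq_square algebra_simps)
    then have k: "k = (2 * j + 1)\<^sup>2"
      using * by simp
    have "CARD('a) = q\<^sup>2" "n = 2" "(2 * \<gamma>) ^ (2 * j + 1) = 1"
      using * card unfolding h by blast+
    with inj_trace_half_norm_square[OF q _ j, of \<gamma>] show ?thesis
      by (simp only: sum2 flip: k)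
  next
    assume "n = 2 \<and> (\<exists>Q::nat. primepow Q \<and> Q > 0 \<and> odd Q \<and> q = Q ^ 2 \<and> \<gamma> = -1 \<and> k = Q ^ 3 - Q + 1)"
    then show ?thesis
      using quartic by blast
  next
    assume "n = 2 \<and> (\<exists>Q::nat. primepow Q \<and> Q > 0 \<and> odd Q \<and> q = Q ^ 2 \<and> \<gamma> = -1 \<and> k = Q ^ 3 + Q ^ 2 - Q)"
    then show ?thesis
      using quartic by blast
  next
    assume *: "n = 3 \<and> odd q \<and> \<gamma> = 1 \<and> k = (q ^ 2 + 1) div 2"
    then obtain j where j: "q = 2 * j + 1"
      by (auto elim: oddE)
    have "q ^ 2 + 1 = 2 * (2 * j * (j + 1) + 1)"
      by (simp add: j power2_eq_square algebra_simps)
    then have k: "k = 2 * j * (j + 1) + 1"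
      using * by simp
    have "CARD('a) = q ^ 3" "n = 3" "\<gamma> = 1"
      using * card by simp_all
    with inj_trace_cubic_half[OF q _ j, where 'a = 'a] show ?thesis
      by (simp only: sum3 flip: k) simp
  next
    assume *: "n = 3 \<and> odd q \<and> \<gamma> = - (1 / 2) \<and> k = q ^ 2 - q + 1"
    then have n: "n = 3" and \<gamma>: "\<gamma> = - (1 / 2)" and k: "k = q ^ 2 - q + 1"
      by simp_all
    have "inj (\<lambda>x::'a. x - (x ^ k + (x ^ k) ^ q + ((x ^ k) ^ q) ^ q) / 2)"
      unfolding k using * card by (intro inj_trace_cubic_doubling[OF q _ two]) simp_all
    then show ?thesis
      unfolding n sum3 unfolding \<gamma> by simp
  next
    assume "\<exists>l r::nat. l > 0 \<and> r > 0 \<and> n = 2 * l * r \<and> \<gamma> ^ (q ^ (2 * l) - 1) = -1 \<and> k = q ^ l + 1"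
    then obtain l r where "n = 2 * l * r" "\<gamma> ^ (q ^ (2 * l) - 1) = -1" and k: "k = q ^ l + 1"
      by blast
    then show ?thesis
      unfolding k by (intro inj_trace_trace_quadratic[OF q card])
  qed
  then show ?thesis
    unfolding permutation_poly_trace_iff_inj .
qed

end
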